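(* For every positive integer $n$, $\mathrm{sat}^*(n,\mathcal{V}_3)\geq \frac{n}{2}$.
   Context: Let $[n]=\{1,\dots,n\}$ and let $\mathcal{P}([n])$ be the power set of $[n]$ ordered by inclusion. A family $\mathcal{F}\subseteq\mathcal{P}([n])$ is regarded as a poset under inclusion. A poset $(\mathcal{Q},\leq')$ contains an induced copy of a poset $(\mathcal{P},\leq)$ if there is an injective function $f:\mathcal{P}\to\mathcal{Q}$ such that for all $u,v\in\mathcal{P}$, $u\leq v$ if and only if $f(u)\leq' f(v)$; otherwise $\mathcal{Q}$ is $\mathcal{P}$-free. A family $\mathcal{F}\subseteq\mathcal{P}([n])$ is $\mathcal{P}$-saturated if $\mathcal{F}$ is $\mathcal{P}$-free but $\mathcal{F}\cup\{S\}$ contains an induced copy of $\mathcal{P}$ for every $S\in\mathcal{P}([n])\setminus\mathcal{F}$. The induced saturation number $\mathrm{sat}^*(n,\mathcal{P})$ is the minimum size of a $\mathcal{P}$-saturated family in $\mathcal{P}([n])$. $\mathcal{V}_3$ is the four-element poset with one minimum element lying below three pairwise incomparable maximal elements. *)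

theory Defs
  imports Complex_Main
begin

(* A poset is a carrier set together with an order relation, used only on that carrier. *)

definition contains_induced_copy ::
  "'b set \<Rightarrow> ('b \<Rightarrow> 'b \<Rightarrow> bool) \<Rightarrow> 'a set \<Rightarrow> ('a \<Rightarrow> 'a \<Rightarrow> bool) \<Rightarrow> bool" where
  "contains_induced_copy Q leQ P leP \<longleftrightarrow>
     (\<exists>f. inj_on f P \<and> f ` P \<subseteq> Q \<and> (\<forall>u\<in>P. \<forall>v\<in>P. leP u v \<longleftrightarrow> leQ (f u) (f v)))"

definition poset_free :: "'a set \<Rightarrow> ('a \<Rightarrow> 'a \<Rightarrow> bool) \<Rightarrow> nat set set \<Rightarrow> bool" where
  "poset_free P leP F \<longleftrightarrow> \<not> contains_induced_copy F (\<subseteq>) P leP"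

definition saturated :: "nat \<Rightarrow> 'a set \<Rightarrow> ('a \<Rightarrow> 'a \<Rightarrow> bool) \<Rightarrow> nat set set \<Rightarrow> bool" where
  "saturated n P leP F \<longleftrightarrow>
     F \<subseteq> Pow {1..n} \<and> poset_free P leP F \<and>
     (\<forall>S \<in> Pow {1..n} - F. contains_induced_copy (F \<union> {S}) (\<subseteq>) P leP)"

(* Min is applied to a finite set, which is nonempty whenever P is: see sat_star_attained. *)
definition sat_star :: "nat \<Rightarrow> 'a set \<Rightarrow> ('a \<Rightarrow> 'a \<Rightarrow> bool) \<Rightarrow> nat" where
  "sat_star n P leP = Min (card ` {F. saturated n P leP F})"

(* 0 is the minimum; 1, 2, 3 are the three pairwise incomparable maximal elements. *)
definition V3 :: "nat set" where
  "V3 = {0, 1, 2, 3}"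

definition V3_le :: "nat \<Rightarrow> nat \<Rightarrow> bool" where
  "V3_le u v \<longleftrightarrow> u = v \<or> u = 0"

lemma finite_saturated: "finite {F. saturated n P leP F}"
  by (rule finite_subset[of _ "Pow (Pow {1..n})"]) (auto simp: saturated_def)

lemma saturated_exists:
  assumes "P \<noteq> {}"
  shows "\<exists>F. saturated n P leP F"
proof -
  define A where "A = {F. F \<subseteq> Pow {1..n} \<and> poset_free P leP F}"
  have "finite A"
    unfolding A_def by (rule finite_subset[of _ "Pow (Pow {1..n})"]) auto
  moreover have "{} \<in> A"
    using assms by (auto simp: A_def poset_free_def contains_induced_copy_def)
  then have "A \<noteq> {}" by blast
  ultimately obtain F where F: "F \<in> A" and max: "\<And>G. G \<in> A \<Longrightarrow> F \<subseteq> G \<Longrightarrow> F = G"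
    using finite_has_maximal by metis
  have "contains_induced_copy (F \<union> {S}) (\<subseteq>) P leP" if S: "S \<in> Pow {1..n} - F" for S
  proof (rule ccontr)
    assume "\<not> contains_induced_copy (F \<union> {S}) (\<subseteq>) P leP"
    then have "F \<union> {S} \<in> A"
      using F S by (simp add: A_def poset_free_def)
    from max[OF this] have "F = F \<union> {S}"
      by blast
    then show False
      using S by blast
  qed
  then show ?thesis
    using F unfolding saturated_def A_def by blast
qed

lemma sat_star_attained:
  assumes "P \<noteq> {}"
  shows "\<exists>F. saturated n P leP F \<and> card F = sat_star n P leP"
proof -
  have "finite (card ` {F. saturated n P leP F})"
    by (rule finite_imageI[OF finite_saturated])
  moreover have "card ` {F. saturated n P leP F} \<noteq> {}"
    using saturated_exists[OF assms] by simp
  ultimately have "sat_star n P leP \<in> card ` {F. saturated n P leP F}"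
    unfolding sat_star_def by (rule Min_in)
  then show ?thesis by auto
qed

end

theory Submission
  imports Defs
begin

text \<open>
  Let \<open>F\<close> be saturated and fix an inclusion-minimal member \<open>N\<close> of \<open>F\<close>. As \<open>F\<close> has no induced fork,
  no three pairwise incomparable members of \<open>F\<close> lie above a common member; in particular the
  members above \<open>N\<close> have width at most two. Every \<open>i \<in> {1..n}\<close> is charged to a member of \<open>F\<close>.

  For \<open>i \<notin> N\<close>, let \<open>A\<close> be maximal among the members that contain \<open>N\<close> and avoid \<open>i\<close>. Looking at
  \<open>insert i A\<close>, which is either a member or the top of a new fork, yields a member \<open>W\<close> with
  \<open>W - A = {i}\<close> (lemma \<open>outside_witness\<close>). If three points \<open>i\<close> had the same \<open>W\<close>, the three sets \<open>A\<close>
  would be pairwise incomparable above \<open>N\<close>. So each \<open>W\<close> is charged at most twice.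

  For \<open>j \<in> N\<close>, the set \<open>N - {j}\<close> is not a member, and it can only be the bottom of a new fork. One of
  the tops of that fork avoids \<open>j\<close>. Hence some member \<open>B\<close> satisfies \<open>N - B = {j}\<close>
  (lemma \<open>inside_witness\<close>), and different \<open>j\<close> have different \<open>B\<close>.

  The two kinds of charged members are disjoint if each \<open>B\<close> is chosen maximal: every \<open>W\<close> either
  contains \<open>N\<close> or lies strictly below a member that does not contain \<open>N\<close>, and neither is possible
  for a maximal \<open>B\<close>. Altogether \<open>card F \<ge> (n - card N) / 2 + card N \<ge> n / 2\<close>.
\<close>

section \<open>Forks in set families\<close>

definition incomparable3 :: "'a set \<Rightarrow> 'a set \<Rightarrow> 'a set \<Rightarrow> bool" where
  "incomparable3 A B C \<longleftrightarrow>
     \<not> A \<subseteq> B \<and> \<not> B \<subseteq> A \<and> \<not> A \<subseteq> C \<and> \<not> C \<subseteq> A \<and> \<not> B \<subseteq> C \<and> \<not> C \<subseteq> B"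

text \<open>
  Weak inclusions suffice for the bottom \<open>M\<close>: a set equal to one top and included in the others
  would make the tops comparable.
\<close>

definition has_fork :: "'a set set \<Rightarrow> bool" where
  "has_fork F \<longleftrightarrow>
     (\<exists>M\<in>F. \<exists>A\<in>F. \<exists>B\<in>F. \<exists>C\<in>F. M \<subseteq> A \<and> M \<subseteq> B \<and> M \<subseteq> C \<and> incomparable3 A B C)"

lemma contains_V3_iff_has_fork:
  "contains_induced_copy F (\<subseteq>) V3 V3_le \<longleftrightarrow> has_fork F"
proof
  assume "contains_induced_copy F (\<subseteq>) V3 V3_le"
  then obtain f where f: "f ` V3 \<subseteq> F"
    "\<forall>u\<in>V3. \<forall>v\<in>V3. V3_le u v \<longleftrightarrow> f u \<subseteq> f v"
    unfolding contains_induced_copy_def by blast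
  have "f 0 \<in> F" "f 1 \<in> F" "f 2 \<in> F" "f 3 \<in> F"
    using f(1) by (auto simp: V3_def)
  moreover have "f 0 \<subseteq> f 1" "f 0 \<subseteq> f 2" "f 0 \<subseteq> f 3" "incomparable3 (f 1) (f 2) (f 3)"
    using f(2) by (auto simp: V3_def V3_le_def incomparable3_def)
  ultimately show "has_fork F"
    unfolding has_fork_def by blast
next
  assume "has_fork F"
  then obtain M A B C where F: "M \<in> F" "A \<in> F" "B \<in> F" "C \<in> F"
    and le: "M \<subseteq> A" "M \<subseteq> B" "M \<subseteq> C" and inc: "incomparable3 A B C"
    unfolding has_fork_def by blast
  define f :: "nat \<Rightarrow> _" where
    "f u = (if u = 0 then M else if u = 1 then A else if u = 2 then B else C)" for u
  have vals: "f 0 = M" "f 1 = A" "f (Suc 0) = A" "f 2 = B" "f 3 = C"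
    by (simp_all add: f_def)
  have order: "\<forall>u\<in>V3. \<forall>v\<in>V3. V3_le u v \<longleftrightarrow> f u \<subseteq> f v"
    using le inc unfolding V3_def V3_le_def incomparable3_def by (simp add: vals) blast
  have "inj_on f V3"
  proof (rule inj_onI)
    fix u v assume "u \<in> V3" "v \<in> V3" "f u = f v"
    then have "V3_le u v" "V3_le v u"
      using order by auto
    then show "u = v"
      unfolding V3_le_def by auto
  qed
  moreover have "f ` V3 \<subseteq> F"
    using F by (auto simp: V3_def vals)
  ultimately show "contains_induced_copy F (\<subseteq>) V3 V3_le"
    using order unfolding contains_induced_copy_def by blast
qed

lemma has_fork_insert_cases:
  assumes "has_fork (insert S F)" "\<not> has_fork F"
  obtains (bottom) A B C where "A \<in> F" "B \<in> F" "C \<in> F" "S \<subseteq> A" "S \<subseteq> B" "S \<subseteq> C"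
      "incomparable3 A B C"
  | (top) M B C where "M \<in> F" "B \<in> F" "C \<in> F" "M \<subseteq> S" "M \<subseteq> B" "M \<subseteq> C"
      "incomparable3 S B C"
proof -
  obtain M A B C where mem: "M \<in> insert S F" "A \<in> insert S F" "B \<in> insert S F" "C \<in> insert S F"
    and le: "M \<subseteq> A" "M \<subseteq> B" "M \<subseteq> C" and inc: "incomparable3 A B C"
    using assms(1) unfolding has_fork_def by blast
  have ne: "M \<noteq> A" "M \<noteq> B" "M \<noteq> C" "A \<noteq> B" "A \<noteq> C" "B \<noteq> C"
    using le inc unfolding incomparable3_def by blast+
  consider "M = S" | "A = S" | "B = S" | "C = S" | "M \<in> F" "A \<in> F" "B \<in> F" "C \<in> F"
    using mem by blast
  then show thesis
  proof cases
    case 1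
    then show ?thesis using bottom[of A B C] mem le inc ne by blast
  next
    case 2
    then show ?thesis using top[of M B C] mem le inc ne by blast
  next
    case 3
    moreover have "incomparable3 B A C" using inc unfolding incomparable3_def by blast
    ultimately show ?thesis using top[of M A C] mem le ne by blast
  next
    case 4
    moreover have "incomparable3 C A B" using inc unfolding incomparable3_def by blast
    ultimately show ?thesis using top[of M A B] mem le ne by blast
  next
    case 5
    then show ?thesis using assms(2) le inc unfolding has_fork_def by blast
  qed
qed

section \<open>Witnesses around a minimal member\<close>

locale saturated_fork_free =
  fixes n :: nat and F :: "nat set set" and N :: "nat set"
  assumes members: "F \<subseteq> Pow {1..n}"
    and fork_free: "\<not> has_fork F"
    and new_fork: "\<And>S. S \<subseteq> {1..n} \<Longrightarrow> S \<notin> F \<Longrightarrow> has_fork (insert S F)"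
    and N_member: "N \<in> F"
    and N_minimal: "\<And>X. X \<in> F \<Longrightarrow> X \<subseteq> N \<Longrightarrow> X = N"
begin

lemma finite_F: "finite F"
  using members finite_subset by blast

lemma N_subset: "N \<subseteq> {1..n}"
  using members N_member by blast

lemma no_incomparable3_above:
  assumes "M \<in> F" "A \<in> F" "B \<in> F" "C \<in> F" "M \<subseteq> A" "M \<subseteq> B" "M \<subseteq> C"
  shows "\<not> incomparable3 A B C"
  using assms fork_free unfolding has_fork_def by blast

text \<open>
  If \<open>insert i A\<close> is not a member, it cannot be the bottom of a new fork, because \<open>A\<close> would serve as
  well. So it is a top, and the bottom \<open>W\<close> of that fork has to contain \<open>i\<close>: otherwise \<open>A\<close> could
  replace \<open>insert i A\<close> as a top.

  The last disjunct is what keeps \<open>W\<close> apart from the maximal members \<open>B\<close> with \<open>N - B = {j}\<close>.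
  It comes from the other two tops of the new fork: if both contained \<open>N\<close>, then together with
  \<open>A\<close> they would be three pairwise incomparable members above \<open>N\<close>.
\<close>

lemma outside_witness:
  assumes i: "i \<in> {1..n} - N"
  shows "\<exists>W. W \<in> F \<and> (\<exists>A\<in>F. N \<subseteq> A \<and> W - A = {i}) \<and>
    (N \<subseteq> W \<or> (\<exists>D\<in>F. W \<subset> D \<and> \<not> N \<subseteq> D))"
proof -
  have "finite {A \<in> F. N \<subseteq> A \<and> i \<notin> A}" "{A \<in> F. N \<subseteq> A \<and> i \<notin> A} \<noteq> {}"
    using finite_F N_member i by auto
  from finite_has_maximal[OF this]
  obtain A where A: "A \<in> F" "N \<subseteq> A" "i \<notin> A"
    and max: "\<forall>X\<in>{A \<in> F. N \<subseteq> A \<and> i \<notin> A}. A \<subseteq> X \<longrightarrow> A = X"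
    by blast
  have A_max: "X = A" if "X \<in> F" "A \<subseteq> X" "i \<notin> X" for X
    using max A(2) that by blast
  show ?thesis
  proof (cases "insert i A \<in> F")
    case True
    have "insert i A - A = {i}" "N \<subseteq> insert i A"
      using A by auto
    then show ?thesis
      using True A by blast
  next
    case False
    have "insert i A \<subseteq> {1..n}"
      using A(1) i members by blast
    from new_fork[OF this False] fork_free show ?thesis
    proof (cases rule: has_fork_insert_cases)
      case (bottom B C D)
      then show ?thesis
        using no_incomparable3_above[OF A(1), of B C D] by blast
    next
      case (top M B C)
      have "\<not> B \<subseteq> A" "\<not> C \<subseteq> A" "\<not> B \<subseteq> C" "\<not> C \<subseteq> B"
        using top(7) unfolding incomparable3_def by blast+
      \<comment> \<open>By maximality of \<open>A\<close>, a top above \<open>A\<close> is \<open>A\<close> itself or contains \<open>i\<close>; in both cases it is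
        comparable with \<open>insert i A\<close>.\<close>
      moreover have "\<not> A \<subseteq> B" "\<not> A \<subseteq> C"
        using top(2,3,7) A_max[of B] A_max[of C] unfolding incomparable3_def by blast+
      ultimately have inc: "incomparable3 A B C"
        unfolding incomparable3_def by blast
      have "\<not> M \<subseteq> A"
        using no_incomparable3_above[OF top(1) A(1) top(2,3)] top(5,6) inc by blast
      then have "M - A = {i}"
        using top(4) by blast
      have "\<not> N \<subseteq> B \<or> \<not> N \<subseteq> C"
        using no_incomparable3_above[OF N_member A(1) top(2,3) A(2)] inc by blast
      moreover have "M \<subset> B" "M \<subset> C"
        using top(5,6) \<open>\<not> B \<subseteq> C\<close> \<open>\<not> C \<subseteq> B\<close> by blast+
      ultimately have "\<exists>D\<in>F. M \<subset> D \<and> \<not> N \<subseteq> D"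
        using top(2,3) by metis
      then show ?thesis
        using \<open>M - A = {i}\<close> top(1) A(1,2) by (intro exI[of _ M] conjI bexI[of _ A]) simp_all
    qed
  qed
qed

text \<open>
  Minimality of \<open>N\<close> excludes that \<open>N - {j}\<close> is a member or a top of a new fork. It is thus the bottom,
  and the three tops cannot all contain \<open>j\<close>, since they would then all lie above \<open>N\<close>.
\<close>

lemma inside_witness:
  assumes j: "j \<in> N"
  shows "\<exists>B. B \<in> F \<and> N - B = {j} \<and> (\<forall>D\<in>F. B \<subset> D \<longrightarrow> N \<subseteq> D)"
proof -
  have not_mem: "N - {j} \<notin> F"
    using N_minimal[of "N - {j}"] j by blast
  have "N - {j} \<subseteq> {1..n}"
    using N_subset by blast
  from new_fork[OF this not_mem] fork_free have "\<exists>B\<in>F. N - {j} \<subseteq> B \<and> j \<notin> B"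
  proof (cases rule: has_fork_insert_cases)
    case (bottom A B C)
    have "\<not> (N \<subseteq> A \<and> N \<subseteq> B \<and> N \<subseteq> C)"
      using no_incomparable3_above[OF N_member bottom(1,2,3)] bottom(7) by blast
    then show ?thesis
      using bottom(1-6) by blast
  next
    case (top M B C)
    then show ?thesis
      using N_minimal[of M] j by blast
  qed
  then have "{B \<in> F. N - {j} \<subseteq> B \<and> j \<notin> B} \<noteq> {}"
    by blast
  moreover have "finite {B \<in> F. N - {j} \<subseteq> B \<and> j \<notin> B}"
    using finite_F by simp
  ultimately obtain B where B: "B \<in> F" "N - {j} \<subseteq> B" "j \<notin> B"
    and max: "\<forall>D\<in>{B \<in> F. N - {j} \<subseteq> B \<and> j \<notin> B}. B \<subseteq> D \<longrightarrow> B = D"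
    using finite_has_maximal[of "{B \<in> F. N - {j} \<subseteq> B \<and> j \<notin> B}"] by blast
  have "N \<subseteq> D" if "D \<in> F" "B \<subset> D" for D
    using max B(2) that by blast
  moreover have "N - B = {j}"
    using B j by blast
  ultimately show ?thesis
    using B(1) by blast
qed

end

section \<open>Counting the witnesses\<close>

lemma card_le_twice_card_image:
  assumes "finite I"
    and no3: "\<And>x y z. x \<in> I \<Longrightarrow> y \<in> I \<Longrightarrow> z \<in> I \<Longrightarrow> f x = f y \<Longrightarrow> f y = f z
      \<Longrightarrow> x = y \<or> x = z \<or> y = z"
  shows "card I \<le> 2 * card (f ` I)"
proof -
  have fiber: "card {x \<in> I. f x = w} \<le> 2" for w
  proof (rule ccontr)
    assume "\<not> card {x \<in> I. f x = w} \<le> 2"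
    then have "3 \<le> card {x \<in> I. f x = w}"
      by simp
    then obtain T where T: "T \<subseteq> {x \<in> I. f x = w}" "card T = 3"
      by (rule obtain_subset_with_card_n)
    from T(2) obtain x y z where "T = {x, y, z} \<and> x \<noteq> y \<and> y \<noteq> z \<and> x \<noteq> z"
      unfolding card_3_iff by (elim exE)
    then show False
      using T(1) no3[of x y z] by simp
  qed
  have "card I = (\<Sum>w\<in>f ` I. card {x \<in> I. f x = w})"
    using sum.image_gen[OF \<open>finite I\<close>, of "\<lambda>_. 1::nat" f] by simp
  also have "\<dots> \<le> (\<Sum>w\<in>f ` I. 2)"
    by (intro sum_mono fiber)
  finally show ?thesis
    by simp
qed

context saturated_fork_free
begin

lemma card_lower_bound: "n \<le> 2 * card F"
proof -
  define I where "I = {1..n} - N"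
  have "\<forall>i\<in>I. \<exists>W. W \<in> F \<and> (\<exists>A\<in>F. N \<subseteq> A \<and> W - A = {i}) \<and>
      (N \<subseteq> W \<or> (\<exists>D\<in>F. W \<subset> D \<and> \<not> N \<subseteq> D))"
    unfolding I_def by (intro ballI outside_witness)
  from bchoice[OF this] obtain W where "\<forall>i\<in>I. W i \<in> F \<and>
      (\<exists>A\<in>F. N \<subseteq> A \<and> W i - A = {i}) \<and> (N \<subseteq> W i \<or> (\<exists>D\<in>F. W i \<subset> D \<and> \<not> N \<subseteq> D))"
    by (elim exE)
  then have W_member: "W i \<in> F"
    and W_diff: "\<exists>A\<in>F. N \<subseteq> A \<and> W i - A = {i}"
    and W_sep: "N \<subseteq> W i \<or> (\<exists>D\<in>F. W i \<subset> D \<and> \<not> N \<subseteq> D)" if "i \<in> I" for i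
    using that by simp_all
  have "\<forall>j\<in>N. \<exists>B. B \<in> F \<and> N - B = {j} \<and> (\<forall>D\<in>F. B \<subset> D \<longrightarrow> N \<subseteq> D)"
    by (intro ballI inside_witness)
  from bchoice[OF this] obtain B where "\<forall>j\<in>N. B j \<in> F \<and> N - B j = {j} \<and>
      (\<forall>D\<in>F. B j \<subset> D \<longrightarrow> N \<subseteq> D)"
    by (elim exE)
  then have B_member: "B j \<in> F" and B_diff: "N - B j = {j}"
    and B_max: "\<forall>D\<in>F. B j \<subset> D \<longrightarrow> N \<subseteq> D" if "j \<in> N" for j
    using that by simp_all
  have outside: "card I \<le> 2 * card (W ` I)"
  proof (rule card_le_twice_card_image)
    fix x y z assume I: "x \<in> I" "y \<in> I" "z \<in> I" and eq: "W x = W y" "W y = W z"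
    show "x = y \<or> x = z \<or> y = z"
    proof (rule ccontr)
      assume ne: "\<not> (x = y \<or> x = z \<or> y = z)"
      obtain A\<^sub>x where x: "A\<^sub>x \<in> F" "N \<subseteq> A\<^sub>x" "W z - A\<^sub>x = {x}"
        using W_diff[OF I(1)] unfolding eq by (elim bexE conjE)
      obtain A\<^sub>y where y: "A\<^sub>y \<in> F" "N \<subseteq> A\<^sub>y" "W z - A\<^sub>y = {y}"
        using W_diff[OF I(2)] unfolding eq by (elim bexE conjE)
      obtain A\<^sub>z where z: "A\<^sub>z \<in> F" "N \<subseteq> A\<^sub>z" "W z - A\<^sub>z = {z}"
        using W_diff[OF I(3)] unfolding eq by (elim bexE conjE)
      \<comment> \<open>Each of the three sets misses exactly its own index among \<open>x\<close>, \<open>y\<close>, \<open>z\<close>.\<close>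
      have "x \<in> W z" "y \<in> W z" "z \<in> W z"
        using x(3) y(3) z(3) by auto
      then have "x \<notin> A\<^sub>x" "y \<in> A\<^sub>x" "z \<in> A\<^sub>x" "x \<in> A\<^sub>y" "y \<notin> A\<^sub>y" "z \<in> A\<^sub>y"
        "x \<in> A\<^sub>z" "y \<in> A\<^sub>z" "z \<notin> A\<^sub>z"
        using x(3) y(3) z(3) ne by auto
      then have "incomparable3 A\<^sub>x A\<^sub>y A\<^sub>z"
        unfolding incomparable3_def by auto
      then show False
        using no_incomparable3_above[OF N_member x(1) y(1) z(1) x(2) y(2) z(2)] by simp
    qed
  qed (simp add: I_def)
  have inside: "card (B ` N) = card N"
  proof (rule card_image, rule inj_onI)
    fix j k assume jk: "j \<in> N" "k \<in> N" and eq: "B j = B k"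
    have "{j} = {k}"
      using B_diff[OF jk(1)] unfolding eq B_diff[OF jk(2)] by (rule sym)
    then show "j = k"
      by simp
  qed
  have disjoint: "W ` I \<inter> B ` N = {}"
  proof -
    have "W i \<noteq> B j" if i: "i \<in> I" and j: "j \<in> N" for i j
    proof
      assume eq: "W i = B j"
      have "\<not> N \<subseteq> W i"
        using B_diff[OF j] unfolding eq by auto
      then obtain D where "D \<in> F" "B j \<subset> D" "\<not> N \<subseteq> D"
        using W_sep[OF i] unfolding eq by auto
      then show False
        using B_max[OF j] by simp
    qed
    then show ?thesis
      by auto
  qed
  have "finite N"
    using N_subset finite_subset by blast
  have "card (W ` I) + card (B ` N) = card (W ` I \<union> B ` N)"
    using disjoint \<open>finite N\<close> by (simp add: card_Un_disjoint I_def)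
  also have "\<dots> \<le> card F"
    using W_member B_member by (intro card_mono finite_F) auto
  finally have "card (W ` I) + card N \<le> card F"
    using inside by simp
  moreover have "card I + card N = n"
    unfolding I_def using card_Diff_subset[OF \<open>finite N\<close> N_subset] card_mono[OF _ N_subset] by simp
  ultimately show ?thesis
    using outside by linarith
qed

end

lemma saturated_V3_card_ge:
  assumes "saturated n V3 V3_le F"
  shows "n \<le> 2 * card F"
proof -
  have F: "F \<subseteq> Pow {1..n}" "\<not> has_fork F"
    and new: "\<And>S. S \<subseteq> {1..n} \<Longrightarrow> S \<notin> F \<Longrightarrow> has_fork (insert S F)"
    using assms by (auto simp: saturated_def poset_free_def contains_V3_iff_has_fork)
  have "\<not> has_fork {{}}"
    by (simp add: has_fork_def incomparable3_def)
  then have "F \<noteq> {}"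
    using new[of "{}"] by auto
  moreover have "finite F"
    using F(1) finite_subset by blast
  ultimately obtain N where "N \<in> F" "\<And>X. X \<in> F \<Longrightarrow> X \<subseteq> N \<Longrightarrow> X = N"
    using finite_has_minimal[of F] by metis
  then interpret saturated_fork_free n F N
    using F new by unfold_locales auto
  show ?thesis
    by (rule card_lower_bound)
qed

theorem theorem1:
  fixes n :: nat
  assumes "n > 0"
  shows "real (sat_star n V3 V3_le) \<ge> real n / 2"
proof -
  have "V3 \<noteq> {}"
    by (simp add: V3_def)
  from sat_star_attained[OF this, of n V3_le]
  obtain F where F: "saturated n V3 V3_le F" "card F = sat_star n V3 V3_le"
    by (elim exE conjE)
  from saturated_V3_card_ge[OF F(1)] have "n \<le> 2 * sat_star n V3 V3_le"
    unfolding F(2) .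
  then show ?thesis
    by linarith
qed

end
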